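(* Let $$K=\left\{\begin{pmatrix}3&0\\0&1\end{pmatrix},\ \begin{pmatrix}1&0\\0&-3\end{pmatrix},\ \begin{pmatrix}-3&-1\\0&-1\end{pmatrix},\ \begin{pmatrix}-1&0\\0&3\end{pmatrix},\ \begin{pmatrix}2&2\\0&2\end{pmatrix}\right\}\subset\mathbb{R}^3,$$ where the matrix $\begin{pmatrix} x & z\\ 0 & y\end{pmatrix}$ is identified with $(x,y,z)\in\mathbb{R}^3$. Then the triangular hull $\operatorname{conv}_{\mathrm{rc}}K$ is a semialgebraic set. It can be described using the following six linear and four quadratic polynomials, i.e. it is a boolean combination (finite unions and intersections) of inequalities on the polynomials $$\ell_1=x-2,\quad \ell_2=x-1,\quad \ell_3=x+1,\quad \ell_4=y-2,\quad \ell_5=y-1,\quad \ell_6=y+1,$$ $$q_1=60z+5xy-9x-3y+15,\qquad q_2=45z-29xy+26x-35y+44,$$ $$q_3=118z-12xy-57x-19y-36,\qquad q_4=118z-143xy+205x+112y-298.$$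
   Context: Identify the space of upper triangular $2\times2$ real matrices $\begin{pmatrix} x & z\\ 0 & y\end{pmatrix}$ with $\mathbb{R}^3$ with coordinates $(x,y,z)$. The cone of matrices of rank at most one is $\mathcal{D}=\{xy=0\}\subset\mathbb{R}^3$. A function $f:\mathbb{R}^3\to\mathbb{R}$ is rank-one convex if $t\mapsto f(A+tB)$ is convex for every $A\in\mathbb{R}^3$ and every $B\in\mathcal{D}$. For a compact set $K\subset\mathbb{R}^3$, its rank-one convex hull, called the triangular hull of $K$, is $$\operatorname{conv}_{\mathrm{rc}}K=\{A\in\mathbb{R}^3 : f(A)\le \max f(K)\ \text{for all rank-one convex } f:\mathbb{R}^3\to\mathbb{R}\}.$$ A subset of a real vector space is semialgebraic if it can be described as a boolean combination (unions and intersections) of finitely many polynomial inequalities; here the inequalities are sign conditions $p\le 0$, $p\ge 0$, $p<0$, $p>0$ with $p$ one of the listed polynomials. *)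

theory Defs
  imports "HOL-Analysis.Analysis"
begin

text \<open>The identification of \<open>(x, y, z)\<close> with the upper triangular matrix with rows
  \<open>(x, z)\<close> and \<open>(0, y)\<close>; note that \<open>z\<close> is the off-diagonal entry.\<close>

definition tri_mat :: "real^3 \<Rightarrow> real^2^2" where
  "tri_mat A = vector [vector [A $ 1, A $ 3], vector [0, A $ 2]]"

definition rank_one_cone :: "(real^3) set" where
  "rank_one_cone = {A. rank (tri_mat A) \<le> 1}"

lemma rank_one_cone_eq: "rank_one_cone = {A. A $ 1 * A $ 2 = 0}"
proof -
  have "rank (tri_mat A) \<le> 1 \<longleftrightarrow> A $ 1 * A $ 2 = 0" for A
    using det_eq_0_rank[of "tri_mat A"] by (auto simp: det_2 tri_mat_def)
  then show ?thesis by (simp add: rank_one_cone_def)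
qed

definition rank_one_convex :: "(real^3 \<Rightarrow> real) \<Rightarrow> bool" where
  "rank_one_convex f \<longleftrightarrow>
     (\<forall>A. \<forall>B\<in>rank_one_cone. convex_on UNIV (\<lambda>t::real. f (A + t *\<^sub>R B)))"

text \<open>Meant for nonempty compact \<open>K\<close>. A rank-one convex function is continuous,
  because \<open>rank_one_cone\<close> spans the space, so the supremum over \<open>K\<close> is then a maximum.\<close>

definition triangular_hull :: "(real^3) set \<Rightarrow> (real^3) set" where
  "triangular_hull K = {A. \<forall>f. rank_one_convex f \<longrightarrow> f A \<le> (SUP B\<in>K. f B)}"

text \<open>The sets obtained by finite unions and intersections from sign conditions on
  members of \<open>P\<close>. No rule for complements is needed, because the four sign conditions
  are closed under negation; equations arise by intersecting \<open>p \<le> 0\<close> with \<open>p \<ge> 0\<close>.\<close>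

inductive_set sign_combinations :: "('a \<Rightarrow> real) set \<Rightarrow> 'a set set"
  for P :: "('a \<Rightarrow> real) set" where
  le: "p \<in> P \<Longrightarrow> {a. p a \<le> 0} \<in> sign_combinations P"
| ge: "p \<in> P \<Longrightarrow> {a. p a \<ge> 0} \<in> sign_combinations P"
| less: "p \<in> P \<Longrightarrow> {a. p a < 0} \<in> sign_combinations P"
| greater: "p \<in> P \<Longrightarrow> {a. p a > 0} \<in> sign_combinations P"
| union: "S \<in> sign_combinations P \<Longrightarrow> T \<in> sign_combinations P \<Longrightarrow> S \<union> T \<in> sign_combinations P"
| inter: "S \<in> sign_combinations P \<Longrightarrow> T \<in> sign_combinations P \<Longrightarrow> S \<inter> T \<in> sign_combinations P"

definition semialgebraic :: "'a::real_normed_vector set \<Rightarrow> bool" where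
  "semialgebraic S \<longleftrightarrow>
     (\<exists>P. finite P \<and> (\<forall>p\<in>P. real_polynomial_function p) \<and> S \<in> sign_combinations P)"

definition K5 :: "(real^3) set" where
  "K5 = {A. tri_mat A \<in>
     {vector [vector [3, 0], vector [0, 1]],
      vector [vector [1, 0], vector [0, -3]],
      vector [vector [-3, -1], vector [0, -1]],
      vector [vector [-1, 0], vector [0, 3]],
      vector [vector [2, 2], vector [0, 2]]}}"

lemma K5_eq:
  "K5 = {vector [3, 1, 0], vector [1, -3, 0], vector [-3, -1, -1],
         vector [-1, 3, 0], vector [2, 2, 2]}"
proof -
  have "tri_mat A = vector [vector [x, z], vector [0, y]] \<longleftrightarrow> A = vector [x, y, z]"
    for A and x y z :: real
    by (auto simp: tri_mat_def vec_eq_iff forall_2 forall_3)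
  then show ?thesis by (auto simp: K5_def)
qed

end

theory Submission
  imports Defs
begin

text \<open>
  Everything is governed by functions of the form
  \<open>c z + a x y + linear\<close>: they are affine along every direction of the cone \<open>x y = 0\<close>.  So
  they and their negatives are rank-one convex, and on the graph of a function
  \<open>a x y + b x + c y + d\<close> a rank-one convex function is convex in \<open>x\<close> and in \<open>y\<close> separately.
  Convexity in the direction of \<open>z\<close> then fills in whatever lies between two such graphs.

  Write \<open>P1, ..., P5\<close> for the five points in the order in which they are given.  The surface
  \<open>q1 = 0\<close> passes through \<open>P1, P2, P3, P4\<close> and bounds the hull from below; the surface
  \<open>q3 = 0\<close> passes through \<open>P2, P3, P4, P5\<close> and bounds it from above.  In the \<open>x y\<close>-plane both
  quadruples are \<open>T4\<close> configurations: each point lies on the prolongation of one side of a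
  rectangle, in cyclic order.  A separately convex function bounded by \<open>M\<close> at the four points
  is bounded by \<open>M\<close> at the corners of the rectangle (\<open>pinwheel_corners_le\<close>), so both surfaces
  belong to the hull over their rectangle and over the segments joining it to the four points.

  The other two polynomials are corrections of these.  One has
  \<open>4 q2 = 3 q1 - 131 (x + 1) (y - 1)\<close> and \<open>q4 = q3 + 131 (x - 1) (2 - y)\<close>.  Hence \<open>q2 = 0\<close>
  agrees with \<open>q1 = 0\<close> over the lines \<open>x = -1\<close> and \<open>y = 1\<close> and passes through \<open>P5\<close> as well,
  which puts it into the hull over \<open>[-1, 2] \<times> [1, 2]\<close>; likewise \<open>q4 = 0\<close> agrees with \<open>q3 = 0\<close>
  over \<open>x = 1\<close> and \<open>y = 2\<close>, passes through \<open>P1\<close>, and lies in the hull over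
  \<open>[1, 2] \<times> [1, 2]\<close>.  Conversely, replacing the two factors by their positive parts turns
  \<open>-4 q2\<close> and \<open>q4\<close> into rank-one convex functions that are nonpositive at all five points, so
  that \<open>q2 \<ge> 0\<close> and \<open>q4 \<le> 0\<close> are forced where the factors are positive.  Products
  of positive parts alone cut away five quadrants of the \<open>x y\<close>-plane.  The set
  \<open>hull_region\<close> described by these constraints is therefore exactly the hull, and it is
  visibly a boolean combination of sign conditions on the ten polynomials.
\<close>

section \<open>Convexity on lines and separate convexity in the plane\<close>

lemma convex_on_affine: "convex_on UNIV (\<lambda>t::real. p + t * q)"
  by (rule convex_onI) (auto simp: algebra_simps)

lemma convex_on_pos_affine: "convex_on UNIV (\<lambda>t::real. max 0 (p + t * q))"
proof (rule convex_onI)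
  fix t x y :: real
  assume t: "0 < t" "t < 1"
  have "p + ((1 - t) * x + t * y) * q = (1 - t) * (p + x * q) + t * (p + y * q)"
    by (simp add: algebra_simps)
  also have "\<dots> \<le> (1 - t) * max 0 (p + x * q) + t * max 0 (p + y * q)"
    using t by (intro add_mono mult_left_mono) auto
  finally show "max 0 (p + ((1 - t) *\<^sub>R x + t *\<^sub>R y) * q)
      \<le> (1 - t) * max 0 (p + x * q) + t * max 0 (p + y * q)"
    using t by simp
qed simp

lemma convex_on_interval_le:
  fixes h :: "real \<Rightarrow> real"
  assumes "convex_on UNIV h" "h a \<le> M" "h b \<le> M" "a \<le> t" "t \<le> b"
  shows "h t \<le> M"
proof -
  have "convex_on {a..b} h"
    using assms(1) by (rule convex_on_subset) auto
  then have "h t \<le> max (h a) (h b)"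
    using assms(4,5) by (intro convex_on_le_max) auto
  then show ?thesis
    using assms(2,3) by linarith
qed

text \<open>If a convex function exceeds at an inner point a bound that holds at one end, then it must
  grow strictly on the way to the other end.\<close>

lemma convex_on_overshoot:
  fixes h :: "real \<Rightarrow> real"
  assumes h: "convex_on UNIV h" and end_le: "h u \<le> M" and t: "t \<in> open_segment s u"
    and over: "M < h t"
  shows "h t < h s"
proof -
  obtain l where l: "0 < l" "l < 1" "t = (1 - l) *\<^sub>R s + l *\<^sub>R u"
    using t by (auto simp: in_segment)
  have "h t \<le> (1 - l) * h s + l * h u"
    using convex_onD[OF h, of l s u] l by simp
  also have "\<dots> < (1 - l) * h s + l * h t"
    using l end_le over by (intro add_strict_left_mono mult_strict_left_mono) auto
  finally have "(1 - l) * h t < (1 - l) * h s"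
    by (simp add: algebra_simps)
  then show ?thesis
    using l by simp
qed

definition separately_convex :: "(real \<Rightarrow> real \<Rightarrow> real) \<Rightarrow> bool" where
  "separately_convex g \<longleftrightarrow>
     (\<forall>y. convex_on UNIV (\<lambda>x. g x y)) \<and> (\<forall>x. convex_on UNIV (\<lambda>y. g x y))"

lemma separately_convex_horizontal_le:
  assumes "separately_convex g" "g a y \<le> M" "g b y \<le> M" "a \<le> x" "x \<le> b"
  shows "g x y \<le> M"
proof -
  have "convex_on UNIV (\<lambda>x. g x y)"
    using assms(1) by (simp add: separately_convex_def)
  from convex_on_interval_le[OF this assms(2-5)] show ?thesis .
qed

lemma separately_convex_vertical_le:
  assumes "separately_convex g" "g x c \<le> M" "g x d \<le> M" "c \<le> y" "y \<le> d"
  shows "g x y \<le> M"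
proof -
  have "convex_on UNIV (g x)"
    using assms(1) by (simp add: separately_convex_def)
  from convex_on_interval_le[OF this assms(2-5)] show ?thesis .
qed

lemma separately_convex_rectangle_le:
  assumes "separately_convex g" "g a c \<le> M" "g b c \<le> M" "g a d \<le> M" "g b d \<le> M"
    and "a \<le> x" "x \<le> b" "c \<le> y" "y \<le> d"
  shows "g x y \<le> M"
proof -
  have "g x c \<le> M" "g x d \<le> M"
    using assms(2-7) by (auto intro: separately_convex_horizontal_le[OF assms(1)])
  then show ?thesis
    using assms(8,9) by (rule separately_convex_vertical_le[OF assms(1)])
qed

text \<open>This is the classical \<open>T4\<close> argument.  The outer points prolong the sides of the rectangle
  \<open>[a, b] \<times> [c, d]\<close> like the blades of a pinwheel, so every corner lies between an outer
  point and the next corner.  If the value at one corner exceeded \<open>M\<close>, the value at the next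
  corner would be strictly larger, and going round once would give a contradiction.\<close>

lemma pinwheel_corners_le:
  assumes g: "separately_convex g"
    and rect: "a < b" "c < d"
    and outer: "b < r" "s < c" "l < a" "d < u"
    and le: "g r d \<le> M" "g b s \<le> M" "g l c \<le> M" "g a u \<le> M"
  shows "g b d \<le> M" "g a d \<le> M" "g a c \<le> M" "g b c \<le> M"
proof -
  have hor: "convex_on UNIV (\<lambda>x. g x y)" and ver: "convex_on UNIV (g x)" for x y
    using g by (auto simp: separately_convex_def)
  have bd: "g b d < g a d" if "M < g b d"
    using convex_on_overshoot[OF hor le(1), of b a] that rect outer
    by (simp add: open_segment_eq_real_ivl)
  have ad: "g a d < g a c" if "M < g a d"
    using convex_on_overshoot[OF ver le(4), of d c] that rect outer
    by (simp add: open_segment_eq_real_ivl)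
  have ac: "g a c < g b c" if "M < g a c"
    using convex_on_overshoot[OF hor le(3), of a b] that rect outer
    by (simp add: open_segment_eq_real_ivl)
  have bc: "g b c < g b d" if "M < g b c"
    using convex_on_overshoot[OF ver le(2), of c d] that rect outer
    by (simp add: open_segment_eq_real_ivl)
  show "g b d \<le> M" "g a d \<le> M" "g a c \<le> M" "g b c \<le> M"
    using bd ad ac bc by linarith+
qed


section \<open>Rank-one convex functions\<close>

lemma rank_one_convexI:
  assumes "\<And>A B. B $ 1 = 0 \<Longrightarrow> convex_on UNIV (\<lambda>t::real. f (A + t *\<^sub>R B))"
    and "\<And>A B. B $ 2 = 0 \<Longrightarrow> convex_on UNIV (\<lambda>t::real. f (A + t *\<^sub>R B))"
  shows "rank_one_convex f"
  using assms by (auto simp: rank_one_convex_def rank_one_cone_eq)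

lemma rank_one_convex_add:
  assumes "rank_one_convex f" "rank_one_convex g"
  shows "rank_one_convex (\<lambda>A. f A + g A)"
  using assms by (auto simp: rank_one_convex_def intro!: convex_on_add)

text \<open>The coefficient of \<open>t\<^sup>2\<close> along a direction \<open>B\<close> is a multiple of \<open>B $ 1 * B $ 2\<close>, so
  these functions are affine along the cone.\<close>

lemma rank_one_convex_bilinear:
  "rank_one_convex (\<lambda>A. k * A $ 3 + a * A $ 1 * A $ 2 + b * A $ 1 + c * A $ 2 + d)"
proof (rule rank_one_convexI)
  let ?f = "\<lambda>A::real^3. k * A $ 3 + a * A $ 1 * A $ 2 + b * A $ 1 + c * A $ 2 + d"
  fix A B :: "real^3"
  { assume "B $ 1 = 0"
    then have "(\<lambda>t. ?f (A + t *\<^sub>R B)) = (\<lambda>t. ?f A + t * ((a * A $ 1 + c) * B $ 2 + k * B $ 3))"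
      by (auto simp: algebra_simps)
    then show "convex_on UNIV (\<lambda>t. ?f (A + t *\<^sub>R B))"
      by (simp only: convex_on_affine) }
  { assume "B $ 2 = 0"
    then have "(\<lambda>t. ?f (A + t *\<^sub>R B)) = (\<lambda>t. ?f A + t * ((a * A $ 2 + b) * B $ 1 + k * B $ 3))"
      by (auto simp: algebra_simps)
    then show "convex_on UNIV (\<lambda>t. ?f (A + t *\<^sub>R B))"
      by (simp only: convex_on_affine) }
qed

text \<open>Along the cone one of the two factors is a nonnegative constant.\<close>

lemma rank_one_convex_quadrant:
  assumes "0 \<le> k"
  shows "rank_one_convex (\<lambda>A. k * (max 0 (a + b * A $ 1) * max 0 (c + d * A $ 2)))"
proof (rule rank_one_convexI)
  let ?f = "\<lambda>A::real^3. k * (max 0 (a + b * A $ 1) * max 0 (c + d * A $ 2))"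
  fix A B :: "real^3"
  { assume "B $ 1 = 0"
    then have "(\<lambda>t. ?f (A + t *\<^sub>R B)) =
        (\<lambda>t. (k * max 0 (a + b * A $ 1)) * max 0 ((c + d * A $ 2) + t * (d * B $ 2)))"
      by (auto simp: algebra_simps)
    then show "convex_on UNIV (\<lambda>t. ?f (A + t *\<^sub>R B))"
      using assms by (simp only:) (intro convex_on_cmul convex_on_pos_affine; simp) }
  { assume "B $ 2 = 0"
    then have "(\<lambda>t. ?f (A + t *\<^sub>R B)) =
        (\<lambda>t. (k * max 0 (c + d * A $ 2)) * max 0 ((a + b * A $ 1) + t * (b * B $ 1)))"
      by (auto simp: algebra_simps)
    then show "convex_on UNIV (\<lambda>t. ?f (A + t *\<^sub>R B))"
      using assms by (simp only:) (intro convex_on_cmul convex_on_pos_affine; simp) }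
qed

lemma rank_one_convex_vertical_le:
  assumes f: "rank_one_convex f"
    and le: "f (vector [x, y, l]) \<le> M" "f (vector [x, y, u]) \<le> M" and z: "l \<le> z" "z \<le> u"
  shows "f (vector [x, y, z]) \<le> M"
proof -
  have line: "vector [x, y, 0] + t *\<^sub>R (vector [0, 0, 1] :: real^3) = vector [x, y, t]" for t
    by (simp add: vec_eq_iff forall_3)
  have "convex_on UNIV (\<lambda>t. f (vector [x, y, 0] + t *\<^sub>R vector [0, 0, 1]))"
    using f by (auto simp: rank_one_convex_def rank_one_cone_eq)
  then have "convex_on UNIV (\<lambda>t. f (vector [x, y, t]))"
    unfolding line .
  from convex_on_interval_le[OF this] show ?thesis
    using le z by blast
qed

definition on_graph ::
    "(real^3 \<Rightarrow> real) \<Rightarrow> real \<Rightarrow> real \<Rightarrow> real \<Rightarrow> real \<Rightarrow> real \<Rightarrow> real \<Rightarrow> real" where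
  "on_graph f a b c d x y = f (vector [x, y, a * x * y + b * x + c * y + d])"

text \<open>The graph of a bilinear polynomial is doubly ruled by lines parallel to the planes
  \<open>y = 0\<close> and \<open>x = 0\<close>, and all these lines have rank-one directions.\<close>

lemma separately_convex_on_graph:
  assumes f: "rank_one_convex f"
  shows "separately_convex (on_graph f a b c d)"
proof -
  have hor: "vector [x, y, a * x * y + b * x + c * y + d] =
      vector [0, y, c * y + d] + x *\<^sub>R (vector [1, 0, a * y + b] :: real^3)" for x y
    by (simp add: vec_eq_iff forall_3 algebra_simps)
  have ver: "vector [x, y, a * x * y + b * x + c * y + d] =
      vector [x, 0, b * x + d] + y *\<^sub>R (vector [0, 1, a * x + c] :: real^3)" for x y
    by (simp add: vec_eq_iff forall_3 algebra_simps)
  have "convex_on UNIV (\<lambda>x. on_graph f a b c d x y)" for y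
    using f unfolding on_graph_def hor by (auto simp: rank_one_convex_def rank_one_cone_eq)
  moreover have "convex_on UNIV (\<lambda>y. on_graph f a b c d x y)" for x
    using f unfolding on_graph_def ver by (auto simp: rank_one_convex_def rank_one_cone_eq)
  ultimately show ?thesis
    by (simp add: separately_convex_def)
qed

lemma triangular_hull_iff:
  assumes "finite K" "K \<noteq> {}"
  shows "A \<in> triangular_hull K \<longleftrightarrow>
    (\<forall>f M. rank_one_convex f \<longrightarrow> (\<forall>B\<in>K. f B \<le> M) \<longrightarrow> f A \<le> M)"
proof
  assume A: "A \<in> triangular_hull K"
  show "\<forall>f M. rank_one_convex f \<longrightarrow> (\<forall>B\<in>K. f B \<le> M) \<longrightarrow> f A \<le> M"
  proof (intro allI impI)
    fix f M
    assume "rank_one_convex f" "\<forall>B\<in>K. f B \<le> M"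
    then have "f A \<le> (SUP B\<in>K. f B)" "(SUP B\<in>K. f B) \<le> M"
      using A assms(2) by (auto simp: triangular_hull_def intro!: cSUP_least)
    then show "f A \<le> M"
      by linarith
  qed
next
  assume *: "\<forall>f M. rank_one_convex f \<longrightarrow> (\<forall>B\<in>K. f B \<le> M) \<longrightarrow> f A \<le> M"
  have "f B \<le> (SUP B\<in>K. f B)" if "B \<in> K" for f :: "real^3 \<Rightarrow> real" and B
    using that assms(1) by (auto intro!: cSUP_upper)
  with * show "A \<in> triangular_hull K"
    by (auto simp: triangular_hull_def)
qed


section \<open>The hull of the five points\<close>

text \<open>Each disjunction is an implication whose premise confines \<open>(x, y)\<close> to an open or closed
  quadrant; the last five exclude an open quadrant altogether.  What remains of the
  \<open>x y\<close>-plane are three rectangles and four rays, and on the rays the bounds for \<open>z\<close>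
  become contradictory beyond the given points.\<close>

definition hull_region :: "(real^3) set" where
  "hull_region =
    {A. 60 * A $ 3 + 5 * A $ 1 * A $ 2 - 9 * A $ 1 - 3 * A $ 2 + 15 \<ge> 0} \<inter>
    {A. 118 * A $ 3 - 12 * A $ 1 * A $ 2 - 57 * A $ 1 - 19 * A $ 2 - 36 \<le> 0} \<inter>
    ({A. A $ 1 + 1 < 0} \<union> {A. A $ 2 - 1 < 0} \<union>
      {A. 45 * A $ 3 - 29 * A $ 1 * A $ 2 + 26 * A $ 1 - 35 * A $ 2 + 44 \<ge> 0}) \<inter>
    ({A. A $ 1 - 1 < 0} \<union> {A. A $ 2 - 2 > 0} \<union>
      {A. 118 * A $ 3 - 143 * A $ 1 * A $ 2 + 205 * A $ 1 + 112 * A $ 2 - 298 \<le> 0}) \<inter>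
    ({A. A $ 1 - 1 \<le> 0} \<union> {A. A $ 2 - 1 \<ge> 0}) \<inter>
    ({A. A $ 1 - 1 \<ge> 0} \<union> {A. A $ 2 + 1 \<ge> 0}) \<inter>
    ({A. A $ 1 + 1 \<ge> 0} \<union> {A. A $ 2 + 1 \<le> 0}) \<inter>
    ({A. A $ 1 + 1 \<le> 0} \<union> {A. A $ 2 - 2 \<le> 0}) \<inter>
    ({A. A $ 1 - 2 \<le> 0} \<union> {A. A $ 2 - 1 \<le> 0})"

lemma triangular_hull_K5_iff:
  "A \<in> triangular_hull K5 \<longleftrightarrow> (\<forall>f M. rank_one_convex f \<longrightarrow>
     f (vector [3, 1, 0]) \<le> M \<longrightarrow> f (vector [1, -3, 0]) \<le> M \<longrightarrow>
     f (vector [-3, -1, -1]) \<le> M \<longrightarrow> f (vector [-1, 3, 0]) \<le> M \<longrightarrow>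
     f (vector [2, 2, 2]) \<le> M \<longrightarrow> f A \<le> M)"
  by (subst triangular_hull_iff) (auto simp: K5_eq)

lemma triangular_hull_K5_subset: "triangular_hull K5 \<subseteq> hull_region"
proof
  fix A :: "real^3"
  assume A: "A \<in> triangular_hull K5"
  have nonpos: "f A \<le> 0" if "rank_one_convex f" "f (vector [3, 1, 0]) \<le> 0"
    "f (vector [1, -3, 0]) \<le> 0" "f (vector [-3, -1, -1]) \<le> 0"
    "f (vector [-1, 3, 0]) \<le> 0" "f (vector [2, 2, 2]) \<le> 0" for f
    using A that unfolding triangular_hull_K5_iff by blast
  \<comment> \<open>The five assumptions say that the product of the positive parts vanishes at each point.\<close>
  have quadrant: "a + b * A $ 1 \<le> 0 \<or> c + d * A $ 2 \<le> 0"
    if "a + b * 3 \<le> 0 \<or> c + d * 1 \<le> 0" "a + b * 1 \<le> 0 \<or> c + d * (-3) \<le> 0"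
      "a + b * (-3) \<le> 0 \<or> c + d * (-1) \<le> 0" "a + b * (-1) \<le> 0 \<or> c + d * 3 \<le> 0"
      "a + b * 2 \<le> 0 \<or> c + d * 2 \<le> 0" for a b c d
  proof -
    have "1 * (max 0 (a + b * A $ 1) * max 0 (c + d * A $ 2)) \<le> 0"
      by (rule nonpos[OF rank_one_convex_quadrant]) (use that in \<open>auto simp: max_def\<close>)
    then show ?thesis
      by (auto simp: max_def mult_le_0_iff split: if_splits)
  qed
  have q1: "-60 * A $ 3 + -5 * A $ 1 * A $ 2 + 9 * A $ 1 + 3 * A $ 2 + -15 \<le> 0"
    by (rule nonpos[OF rank_one_convex_bilinear]) simp_all
  have q3: "118 * A $ 3 + -12 * A $ 1 * A $ 2 + -57 * A $ 1 + -19 * A $ 2 + -36 \<le> 0"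
    by (rule nonpos[OF rank_one_convex_bilinear]) simp_all
  \<comment> \<open>With the positive parts removed, this is \<open>-4 q2 = -3 q1 + 131 (x + 1) (y - 1)\<close>.\<close>
  have q2': "(-180 * A $ 3 + -15 * A $ 1 * A $ 2 + 27 * A $ 1 + 9 * A $ 2 + -45)
      + 131 * (max 0 (1 + 1 * A $ 1) * max 0 (-1 + 1 * A $ 2)) \<le> 0"
    by (rule nonpos[OF rank_one_convex_add[OF rank_one_convex_bilinear rank_one_convex_quadrant]])
      simp_all
  have q2: "45 * A $ 3 - 29 * A $ 1 * A $ 2 + 26 * A $ 1 - 35 * A $ 2 + 44 \<ge> 0"
    if "A $ 1 \<ge> -1" "A $ 2 \<ge> 1"
    using q2' that by (simp add: max_absorb2 algebra_simps)
  \<comment> \<open>With the positive parts removed, this is \<open>q4 = q3 + 131 (x - 1) (2 - y)\<close>.\<close>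
  have q4': "(118 * A $ 3 + -12 * A $ 1 * A $ 2 + -57 * A $ 1 + -19 * A $ 2 + -36)
      + 131 * (max 0 (-1 + 1 * A $ 1) * max 0 (2 + (-1) * A $ 2)) \<le> 0"
    by (rule nonpos[OF rank_one_convex_add[OF rank_one_convex_bilinear rank_one_convex_quadrant]])
      simp_all
  have q4: "118 * A $ 3 - 143 * A $ 1 * A $ 2 + 205 * A $ 1 + 112 * A $ 2 - 298 \<le> 0"
    if "A $ 1 \<ge> 1" "A $ 2 \<le> 2"
    using q4' that by (simp add: max_absorb2 algebra_simps)
  have quadrants: "A $ 1 - 1 \<le> 0 \<or> A $ 2 - 1 \<ge> 0" "A $ 1 - 1 \<ge> 0 \<or> A $ 2 + 1 \<ge> 0"
    "A $ 1 + 1 \<ge> 0 \<or> A $ 2 + 1 \<le> 0" "A $ 1 + 1 \<le> 0 \<or> A $ 2 - 2 \<le> 0"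
    "A $ 1 - 2 \<le> 0 \<or> A $ 2 - 1 \<le> 0"
    using quadrant[of "-1" 1 1 "-1"] quadrant[of 1 "-1" "-1" "-1"]
      quadrant[of "-1" "-1" 1 1] quadrant[of 1 1 "-2" 1] quadrant[of "-2" 1 "-1" 1]
    by simp_all linarith+
  have "60 * A $ 3 + 5 * A $ 1 * A $ 2 - 9 * A $ 1 - 3 * A $ 2 + 15 \<ge> 0"
    "118 * A $ 3 - 12 * A $ 1 * A $ 2 - 57 * A $ 1 - 19 * A $ 2 - 36 \<le> 0"
    using q1 q3 by simp_all
  moreover have "A $ 1 + 1 < 0 \<or> A $ 2 - 1 < 0 \<or>
      45 * A $ 3 - 29 * A $ 1 * A $ 2 + 26 * A $ 1 - 35 * A $ 2 + 44 \<ge> 0"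
    using q2 by linarith
  moreover have "A $ 1 - 1 < 0 \<or> A $ 2 - 2 > 0 \<or>
      118 * A $ 3 - 143 * A $ 1 * A $ 2 + 205 * A $ 1 + 112 * A $ 2 - 298 \<le> 0"
    using q4 by linarith
  ultimately show "A \<in> hull_region"
    unfolding hull_region_def Int_iff Un_iff mem_Collect_eq using quadrants by blast
qed

lemma hull_region_subset: "hull_region \<subseteq> triangular_hull K5"
proof
  fix A :: "real^3"
  assume A: "A \<in> hull_region"
  define x y z where "x = A $ 1" and "y = A $ 2" and "z = A $ 3"
  have A_eq: "A = vector [x, y, z]"
    by (simp add: x_def y_def z_def vec_eq_iff forall_3)
  have region: "60 * z + 5 * x * y - 9 * x - 3 * y + 15 \<ge> 0"
    "118 * z - 12 * x * y - 57 * x - 19 * y - 36 \<le> 0"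
    "x + 1 < 0 \<or> y - 1 < 0 \<or> 45 * z - 29 * x * y + 26 * x - 35 * y + 44 \<ge> 0"
    "x - 1 < 0 \<or> y - 2 > 0 \<or> 118 * z - 143 * x * y + 205 * x + 112 * y - 298 \<le> 0"
    "x - 1 \<le> 0 \<or> y - 1 \<ge> 0" "x - 1 \<ge> 0 \<or> y + 1 \<ge> 0" "x + 1 \<ge> 0 \<or> y + 1 \<le> 0"
    "x + 1 \<le> 0 \<or> y - 2 \<le> 0" "x - 2 \<le> 0 \<or> y - 1 \<le> 0"
    using A unfolding hull_region_def x_def y_def z_def Int_iff Un_iff mem_Collect_eq
    by blast+
  show "A \<in> triangular_hull K5"
    unfolding triangular_hull_K5_iff
  proof (intro allI impI)
    fix f M
    assume f: "rank_one_convex f"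
      and P1: "f (vector [3, 1, 0]) \<le> M" and P2: "f (vector [1, -3, 0]) \<le> M"
      and P3: "f (vector [-3, -1, -1]) \<le> M" and P4: "f (vector [-1, 3, 0]) \<le> M"
      and P5: "f (vector [2, 2, 2]) \<le> M"
    \<comment> \<open>The restriction of \<open>f\<close> to the surface \<open>qi = 0\<close> is \<open>gi\<close>.\<close>
    define g1 where "g1 = on_graph f (-5/60) (9/60) (3/60) (-15/60)"
    define g2 where "g2 = on_graph f (29/45) (-26/45) (35/45) (-44/45)"
    define g3 where "g3 = on_graph f (12/118) (57/118) (19/118) (36/118)"
    define g4 where "g4 = on_graph f (143/118) (-205/118) (-112/118) (298/118)"
    note g_defs = g1_def g2_def g3_def g4_def
    have conv: "separately_convex g1" "separately_convex g2"
      "separately_convex g3" "separately_convex g4"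
      unfolding g_defs by (intro separately_convex_on_graph f)+
    note horizontal = conv[THEN separately_convex_horizontal_le]
    note vertical = conv[THEN separately_convex_vertical_le]
    note rectangle = conv[THEN separately_convex_rectangle_le]

    have g1_pts: "g1 3 1 \<le> M" "g1 1 (-3) \<le> M" "g1 (-3) (-1) \<le> M" "g1 (-1) 3 \<le> M"
      using P1 P2 P3 P4 by (simp_all add: g1_def on_graph_def)
    have g1_corners: "g1 1 1 \<le> M" "g1 (-1) 1 \<le> M" "g1 (-1) (-1) \<le> M" "g1 1 (-1) \<le> M"
      using pinwheel_corners_le[OF conv(1) _ _ _ _ _ _ g1_pts] by simp_all
    have g3_pts: "g3 2 2 \<le> M" "g3 1 (-3) \<le> M" "g3 (-3) (-1) \<le> M" "g3 (-1) 3 \<le> M"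
      using P5 P2 P3 P4 by (simp_all add: g3_def on_graph_def)
    have g3_corners: "g3 1 2 \<le> M" "g3 (-1) 2 \<le> M" "g3 (-1) (-1) \<le> M" "g3 1 (-1) \<le> M"
      using pinwheel_corners_le[OF conv(3) _ _ _ _ _ _ g3_pts] by simp_all

    have g12: "g2 x 1 = g1 x 1" "g2 (-1) y = g1 (-1) y" for x y
    proof -
      have "29/45 * x * 1 + -26/45 * x + 35/45 * 1 + -44/45
          = -5/60 * x * 1 + 9/60 * x + 3/60 * 1 + -15/60"
        by simp
      then show "g2 x 1 = g1 x 1"
        unfolding g_defs on_graph_def by (simp only:)
      have "29/45 * -1 * y + -26/45 * -1 + 35/45 * y + -44/45
          = -5/60 * -1 * y + 9/60 * -1 + 3/60 * y + -15/60"
        by simp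
      then show "g2 (-1) y = g1 (-1) y"
        unfolding g_defs on_graph_def by (simp only:)
    qed
    have g34: "g4 1 y = g3 1 y" "g4 x 2 = g3 x 2" for x y
    proof -
      have "143/118 * 1 * y + -205/118 * 1 + -112/118 * y + 298/118
          = 12/118 * 1 * y + 57/118 * 1 + 19/118 * y + 36/118"
        by simp
      then show "g4 1 y = g3 1 y"
        unfolding g_defs on_graph_def by (simp only:)
      have "143/118 * x * 2 + -205/118 * x + -112/118 * 2 + 298/118
          = 12/118 * x * 2 + 57/118 * x + 19/118 * 2 + 36/118"
        by simp
      then show "g4 x 2 = g3 x 2"
        unfolding g_defs on_graph_def by (simp only:)
    qed

    have g2_corners: "g2 (-1) 1 \<le> M" "g2 2 1 \<le> M" "g2 (-1) 2 \<le> M" "g2 2 2 \<le> M"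
    proof -
      show "g2 (-1) 1 \<le> M"
        unfolding g12 by (rule g1_corners)
      show "g2 2 1 \<le> M"
        unfolding g12 by (rule horizontal(1)[OF g1_corners(1) g1_pts(1)]) auto
      show "g2 (-1) 2 \<le> M"
        unfolding g12 by (rule vertical(1)[OF g1_corners(2) g1_pts(4)]) auto
      show "g2 2 2 \<le> M"
        using P5 by (simp add: g2_def on_graph_def)
    qed
    have g4_P1: "g4 3 1 \<le> M"
      using P1 by (simp add: g4_def on_graph_def)
    have g4_corners: "g4 1 1 \<le> M" "g4 2 1 \<le> M" "g4 1 2 \<le> M" "g4 2 2 \<le> M"
    proof -
      show "g4 1 1 \<le> M"
        unfolding g34 by (rule vertical(3)[OF g3_corners(4,1)]) auto
      then show "g4 2 1 \<le> M"
        by (rule horizontal(4)[OF _ g4_P1]) auto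
      show "g4 1 2 \<le> M" "g4 2 2 \<le> M"
        unfolding g34 by (rule g3_corners g3_pts)+
    qed

    \<comment> \<open>The fibre of the hull over \<open>(x, y)\<close> lies between a lower surface \<open>q1 = 0\<close> or \<open>q2 = 0\<close>
      and an upper surface \<open>q3 = 0\<close> or \<open>q4 = 0\<close>; there is one fact for each combination.\<close>
    have q13: "g1 x y \<le> M \<Longrightarrow> g3 x y \<le> M \<Longrightarrow> f A \<le> M"
      unfolding A_eq g_defs on_graph_def
      by (erule (1) rank_one_convex_vertical_le[OF f]) (use region in \<open>auto simp: field_simps\<close>)
    have q23: "f A \<le> M" if "x \<ge> -1" "y \<ge> 1" "g2 x y \<le> M" "g3 x y \<le> M"
      using that(3,4) unfolding A_eq g_defs on_graph_def
      by (rule rank_one_convex_vertical_le[OF f]) (use region that in \<open>auto simp: field_simps\<close>)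
    have q14: "f A \<le> M" if "x \<ge> 1" "y \<le> 2" "g1 x y \<le> M" "g4 x y \<le> M"
      using that(3,4) unfolding A_eq g_defs on_graph_def
      by (rule rank_one_convex_vertical_le[OF f]) (use region that in \<open>auto simp: field_simps\<close>)
    have q24: "f A \<le> M" if "x \<ge> 1" "1 \<le> y" "y \<le> 2" "g2 x y \<le> M" "g4 x y \<le> M"
      using that(4,5) unfolding A_eq g_defs on_graph_def
      by (rule rank_one_convex_vertical_le[OF f]) (use region that in \<open>auto simp: field_simps\<close>)

    consider "-1 \<le> x" "x \<le> 1" "-1 \<le> y" "y \<le> 1"
      | "-1 \<le> x" "x \<le> 1" "1 \<le> y" "y \<le> 2"
      | "1 \<le> x" "x \<le> 2" "1 \<le> y" "y \<le> 2"
      | "y = 1" "2 \<le> x" | "x = 1" "y \<le> -1" | "y = -1" "x \<le> -1" | "x = -1" "2 \<le> y"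
      using region(5-9) by smt
    then show "f A \<le> M"
    proof cases
      case 1
      show ?thesis
        by (rule q13; rule rectangle(1)[OF g1_corners(3,4,2,1)] rectangle(3)[OF g3_corners(3,4,2,1)])
          (use 1 in auto)
    next
      case 2
      show ?thesis
        by (rule q23; (rule rectangle(2)[OF g2_corners] rectangle(3)[OF g3_corners(3,4,2,1)])?)
          (use 2 in auto)
    next
      case 3
      show ?thesis
        by (rule q24; (rule rectangle(2)[OF g2_corners] rectangle(4)[OF g4_corners])?) (use 3 in auto)
    next
      case 4
      have "x \<le> 3"
        using region 4 by auto
      then have "g1 x 1 \<le> M" "g4 x 1 \<le> M"
        using 4 horizontal(1)[OF g1_corners(1) g1_pts(1)] horizontal(4)[OF g4_corners(1) g4_P1]
        by auto
      then show ?thesis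
        using q14 4 by simp
    next
      case 5
      have "-3 \<le> y"
        using region 5 by auto
      then have "g1 1 y \<le> M" "g3 1 y \<le> M"
        using 5 vertical(1)[OF g1_pts(2) g1_corners(4)] vertical(3)[OF g3_pts(2) g3_corners(4)]
        by auto
      then show ?thesis
        using q13 5 by simp
    next
      case 6
      have "-3 \<le> x"
        using region 6 by auto
      then have "g1 x (-1) \<le> M" "g3 x (-1) \<le> M"
        using 6 horizontal(1)[OF g1_pts(3) g1_corners(3)] horizontal(3)[OF g3_pts(3) g3_corners(3)]
        by auto
      then show ?thesis
        using q13 6 by simp
    next
      case 7
      have "y \<le> 3"
        using region 7 by auto
      then have "g1 (-1) y \<le> M" "g3 (-1) y \<le> M"
        using 7 vertical(1)[OF g1_corners(2) g1_pts(4)] vertical(3)[OF g3_corners(2) g3_pts(4)]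
        by auto
      then show ?thesis
        using q13 7 by simp
    qed
  qed
qed

lemma triangular_hull_K5: "triangular_hull K5 = hull_region"
  using triangular_hull_K5_subset hull_region_subset by (rule antisym)

theorem theorem4p3:
  shows "semialgebraic (triangular_hull K5) \<and>
    triangular_hull K5 \<in> sign_combinations
      ((\<lambda>p (A::real^3). p (A $ 1) (A $ 2) (A $ 3)) `
       {\<lambda>x y z. x - 2,
        \<lambda>x y z. x - 1,
        \<lambda>x y z. x + 1,
        \<lambda>x y z. y - 2,
        \<lambda>x y z. y - 1,
        \<lambda>x y z. y + 1,
        \<lambda>x y z. 60 * z + 5 * x * y - 9 * x - 3 * y + 15,
        \<lambda>x y z. 45 * z - 29 * x * y + 26 * x - 35 * y + 44,
        \<lambda>x y z. 118 * z - 12 * x * y - 57 * x - 19 * y - 36,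
        \<lambda>x y z. 118 * z - 143 * x * y + 205 * x + 112 * y - 298})"
  (is "_ \<and> _ \<in> sign_combinations ?P")
proof -
  have comb: "triangular_hull K5 \<in> sign_combinations ?P"
    unfolding triangular_hull_K5 hull_region_def
    by (intro sign_combinations.inter sign_combinations.union)
      (rule sign_combinations.le sign_combinations.ge sign_combinations.less
         sign_combinations.greater, simp)+
  have coord: "real_polynomial_function (\<lambda>A::real^3. A $ i)" for i
    by (rule real_polynomial_function.intros(1)) (rule bounded_linear_vec_nth)
  have poly: "\<forall>p\<in>?P. real_polynomial_function p"
    unfolding image_insert image_empty ball_simps
    by (intro conjI TrueI coord real_polynomial_function.intros(2-4) real_polynomial_function_diff)
  have "finite ?P"
    by (intro finite_imageI finite.intros)
  with poly comb have "semialgebraic (triangular_hull K5)"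
    unfolding semialgebraic_def by (intro exI conjI)
  with comb show ?thesis
    by (intro conjI)
qed

end
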